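(* Let $I$ be an open interval in $\mathbb{R}$, let $f:m_{\approx}(I)\to\widehat{\mathbb{R}}$, $g:m_{\approx}(I)\to\widehat{\mathbb{R}}$ be indiscernible extensions of $\phi:I\to\mathbb{R}$, $\psi:I\to\mathbb{R}$, respectively, and let $\xi_0\in I$. Write $D\phi:=\lim_{\xi\to\xi_0}\frac{\phi(\xi)-\phi(\xi_0)}{\xi-\xi_0}$ and $D\psi:=\lim_{\xi\to\xi_0}\frac{\psi(\xi)-\psi(\xi_0)}{\xi-\xi_0}$, when these limits exist in $\mathbb{R}$. a) If $\alpha,\beta$ are fixed real numbers and $f$ is defined by $f(x):=\alpha x+\beta$, then $f$ is differentiable at $\xi_0$, and $f'(x)=\alpha$ for all $x\in m_{\approx}(\xi_0)$. b) Let $f$ and $g$ be differentiable at $\xi_0$. If at least one of $D\phi$, $D\psi$ exists in $\mathbb{R}$, then $f+g$ is differentiable at $\xi_0$, and for each $x\in m_{\approx}(\xi_0)$: $(f+g)'(x)=f'(x)+g'(x)$. c) Let $f$ and $g$ be differentiable at $\xi_0$. In each of the following three cases, $fg$ is differentiable at $\xi_0$, and for each $x\in m_{\approx}(\xi_0)$: $(fg)'(x)=f'(x)g(\xi_0)+g'(x)f(\xi_0)$. (c1) $D\phi$ and $D\psi$ exist in $\mathbb{R}$; (c2) $\phi(\xi_0)\neq0$, $D\phi$ and $\lim_{\xi\to\xi_0}\psi(\xi)$ exist in $\mathbb{R}$, and $D\psi$ does not exist in $\mathbb{R}$; (c3) $\psi(\xi_0)\neq0$, $D\psi$ and $\lim_{\xi\to\xi_0}\phi(\xi)$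 exist in $\mathbb{R}$, and $D\phi$ does not exist in $\mathbb{R}$. d) Let $f$ and $g$ be differentiable at $\xi_0$, and let $\psi(\xi)\neq0$ for each $\xi\in I$. In each of the following three cases, $\frac fg$ is differentiable at $\xi_0$, and for each $x\in m_{\approx}(\xi_0)$: $\left(\frac fg\right)'(x)=\frac{f'(x)g(\xi_0)-g'(x)f(\xi_0)}{g(\xi_0)^2}$. (d1) $D\phi$ and $D\psi$ exist in $\mathbb{R}$; (d2) $\phi(\xi_0)\neq0$, $D\phi$ and $\lim_{\xi\to\xi_0}\frac1{\psi(\xi)}$ exist in $\mathbb{R}$, and $\lim_{\xi\to\xi_0}\frac{\frac1{\psi(\xi)}-\frac1{\psi(\xi_0)}}{\xi-\xi_0}$ does not exist in $\mathbb{R}$; (d3) $\lim_{\xi\to\xi_0}\frac{\frac1{\psi(\xi)}-\frac1{\psi(\xi_0)}}{\xi-\xi_0}$ and $\lim_{\xi\to\xi_0}\phi(\xi)$ exist in $\mathbb{R}$, and $D\phi$ does not exist in $\mathbb{R}$. e) Let $m\in\mathbb{N}$ and let $f$ be differentiable at $\xi_0$. If $D\phi$ exists in $\mathbb{R}$, or if $\phi$ is continuous at $\xi_0$ (in the usual sense), $\phi(\xi_0)\neq0$ and $D\phi$ does not exist in $\mathbb{R}$, then $f^m$ is differentiable at $\xi_0$, and for each $x\in m_{\approx}(\xi_0)$: $(f^m)'(x)=mf(\xi_0)^{m-1}f'(x)$. f) For fixed $m\in\mathbb{N}$, let $f$ be differentiable at $\xi_0$ and let $\phi(\xi)>0$ for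 each $\xi\in I$. Then $\sqrt[m]{f}$ is differentiable at $\xi_0$, and for each $x\in m_{\approx}(\xi_0)$: $(\sqrt[m]{f})'(x)=\frac{f'(x)}{m\sqrt[m]{f(\xi_0)^{m-1}}}$.
   Context: $\widehat{\mathbb{R}}$ is the set of all convergent sequences of real numbers; a real number is identified with the corresponding constant sequence, so $\mathbb{R}\subseteq\widehat{\mathbb{R}}$. $\sigma x\in\mathbb{R}$ is the limit of $x$; $x\approx y$ means $\sigma x=\sigma y$; infinitesimals are the $x$ with $\sigma x=0$; $dx:=x-\sigma x$. For $x=(\xi_n),y=(\eta_n)$: $x+y:=(\xi_n+\eta_n)$, $xy:=(\sigma x\,\eta_n+\sigma y\,\xi_n-\sigma x\,\sigma y)$; $\widehat{\mathbb{R}}$ is then a commutative ring with identity whose invertible elements are exactly the non-infinitesimals, and quotients are taken in this ring; $x^m$ are ring powers, $x^0:=1$. $x<y$ iff $\sigma x<\sigma y$. For $x>0$ and $m>1$, $\sqrt[m]{x}$ is the unique $y\in\widehat{\mathbb{R}}$ with $y>0$ and $y^m=x$; $\sqrt[1]{x}:=x$. $m_{\approx}(x):=\{y\in\widehat{\mathbb{R}}\mid y\approx x\}$ and $m_{\approx}(A):=\bigcup_{x\in A}m_{\approx}(x)$. $\mathbb{N}$ is the set of positive integers. A function $f:m_{\approx}(I)\to\widehat{\mathbb{R}}$ is an indiscernible extension of $\phi:I\to\mathbb{R}$ iff $f(\sigma x)=\phi(\sigma x)$ and $f(x)\approx\phi(\sigma x)$ for all $x\in m_{\approx}(I)$. Such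 an $f$ is differentiable at $\xi_0\in I$ iff there is a real number $\alpha$ with $f(x)=\phi(\xi_0)+\alpha\,dx$ for all $x\in m_{\approx}(\xi_0)$, with the proviso that $\alpha=\lim_{\xi\to\xi_0}\frac{\phi(\xi)-\phi(\xi_0)}{\xi-\xi_0}$ whenever this (usual) limit exists in $\mathbb{R}$. This $\alpha$ is unique and, for each $x\in m_{\approx}(\xi_0)$, it is called the derivative of $f$ at $x$ and denoted $f'(x)$. The functions $f+g$, $fg$, $\frac fg$, $f^m$, $\sqrt[m]{f}$ are defined pointwise and are regarded as indiscernible extensions of $\phi+\psi$, $\phi\psi$, $\frac\phi\psi$, $\phi^m$, $\sqrt[m]{\phi}$, respectively. *)

theory Defs
  imports "HOL-Analysis.Analysis"
begin

typedef hreal = "{X :: nat \<Rightarrow> real. convergent X}"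
  morphisms hseq Abs_hreal
  using convergent_const by blast

setup_lifting type_definition_hreal

lift_definition hlim :: "hreal \<Rightarrow> real" is "lim" .

lift_definition hconst :: "real \<Rightarrow> hreal" is "\<lambda>r _. r"
  by (rule convergent_const)

instantiation hreal :: comm_ring_1
begin

lift_definition zero_hreal :: hreal is "\<lambda>_. 0"
  by (rule convergent_const)

lift_definition one_hreal :: hreal is "\<lambda>_. 1"
  by (rule convergent_const)

lift_definition plus_hreal :: "hreal \<Rightarrow> hreal \<Rightarrow> hreal" is "\<lambda>X Y n. X n + Y n"
  by (rule convergent_add)

lift_definition minus_hreal :: "hreal \<Rightarrow> hreal \<Rightarrow> hreal" is "\<lambda>X Y n. X n - Y n"
  by (rule convergent_diff)

lift_definition uminus_hreal :: "hreal \<Rightarrow> hreal" is "\<lambda>X n. - X n"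
  by (simp add: convergent_minus_iff[symmetric])

text \<open>The product is not the termwise one: it is the linearisation of the termwise product at
  the limits, so that the product of two null sequences is zero.\<close>

lift_definition times_hreal :: "hreal \<Rightarrow> hreal \<Rightarrow> hreal" is
  "\<lambda>X Y n. lim X * Y n + lim Y * X n - lim X * lim Y"
  by (intro convergent_add convergent_diff convergent_mult convergent_const)

instance
proof -
  have tends: "X \<longlonglongrightarrow> lim X" if "convergent X" for X :: "nat \<Rightarrow> real"
    using that by (simp add: convergent_LIMSEQ_iff)
  have lim_add: "lim (\<lambda>n. X n + Y n) = lim X + lim Y"
    if "convergent X" "convergent Y" for X Y :: "nat \<Rightarrow> real"
    by (intro limI tendsto_add tends that)
  have lim_mult: "lim (\<lambda>n. lim X * Y n + lim Y * X n - lim X * lim Y) = lim X * lim Y"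
    if "convergent X" "convergent Y" for X Y :: "nat \<Rightarrow> real"
  proof -
    have "(\<lambda>n. lim X * Y n + lim Y * X n - lim X * lim Y)
            \<longlonglongrightarrow> lim X * lim Y + lim Y * lim X - lim X * lim Y"
      by (intro tendsto_intros tends that)
    then show ?thesis by (simp add: limI)
  qed
  show "OFCLASS(hreal, comm_ring_1_class)"
  proof
    fix a b c :: hreal
    show "a * b * c = a * (b * c)"
      by transfer (simp add: lim_mult fun_eq_iff, simp add: algebra_simps)
    show "(a + b) * c = a * c + b * c"
      by transfer (auto simp: lim_add fun_eq_iff algebra_simps)
    show "a * b = b * a" by transfer (auto simp: fun_eq_iff)
    show "1 * a = a" by transfer (auto simp: fun_eq_iff)
    show "a + b + c = a + (b + c)" by transfer (auto simp: fun_eq_iff)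
    show "a + b = b + a" by transfer (auto simp: fun_eq_iff)
    show "0 + a = a" by transfer auto
    show "- a + a = 0" by transfer auto
    show "a - b = a + - b" by transfer auto
    show "(0::hreal) \<noteq> 1" by transfer (auto simp: fun_eq_iff)
  qed
qed

end

text \<open>Quotients are quotients in the ring; non-units get the dummy inverse \<open>0\<close>.\<close>

definition hinverse :: "hreal \<Rightarrow> hreal" where
  "hinverse x = (if x dvd 1 then THE y. x * y = 1 else 0)"

instantiation hreal :: inverse
begin

definition inverse_hreal :: "hreal \<Rightarrow> hreal" where
  "inverse_hreal = hinverse"

definition divide_hreal :: "hreal \<Rightarrow> hreal \<Rightarrow> hreal" where
  "divide_hreal x y = x * hinverse y"

instance ..

end

text \<open>In the usual notation, \<open>hlim x\<close> is \<open>\<sigma> x\<close>, \<open>hdiff x\<close> is the differential \<open>dx\<close>, and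
  \<open>indisc x y\<close> is \<open>x \<approx> y\<close>. The order
  compares limits only, so distinct indiscernible elements are incomparable.\<close>

definition indisc :: "hreal \<Rightarrow> hreal \<Rightarrow> bool" where
  "indisc x y \<longleftrightarrow> hlim x = hlim y"

definition hless :: "hreal \<Rightarrow> hreal \<Rightarrow> bool" where
  "hless x y \<longleftrightarrow> hlim x < hlim y"

definition hdiff :: "hreal \<Rightarrow> hreal" where
  "hdiff x = x - hconst (hlim x)"

definition hroot :: "nat \<Rightarrow> hreal \<Rightarrow> hreal" where
  "hroot m x = (if m = 1 then x else THE y. hless 0 y \<and> y ^ m = x)"

definition monad :: "hreal \<Rightarrow> hreal set" where
  "monad x = {y. indisc y x}"

definition monad_set :: "hreal set \<Rightarrow> hreal set" where
  "monad_set A = (\<Union>x\<in>A. monad x)"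

text \<open>A function on \<open>I\<close>, or on the monad of \<open>I\<close>, is represented by a total function of which only
  the values there are used. In particular all limits are taken within \<open>I\<close>.\<close>

definition indisc_ext :: "real set \<Rightarrow> (real \<Rightarrow> real) \<Rightarrow> (hreal \<Rightarrow> hreal) \<Rightarrow> bool" where
  "indisc_ext I \<phi> f \<longleftrightarrow>
     (\<forall>x\<in>monad_set (hconst ` I).
        f (hconst (hlim x)) = hconst (\<phi> (hlim x)) \<and> indisc (f x) (hconst (\<phi> (hlim x))))"

definition has_D :: "real set \<Rightarrow> (real \<Rightarrow> real) \<Rightarrow> real \<Rightarrow> real \<Rightarrow> bool" where
  "has_D I \<phi> \<xi>0 l \<longleftrightarrow> ((\<lambda>\<xi>. (\<phi> \<xi> - \<phi> \<xi>0) / (\<xi> - \<xi>0)) \<longlongrightarrow> l) (at \<xi>0 within I)"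

definition D_exists :: "real set \<Rightarrow> (real \<Rightarrow> real) \<Rightarrow> real \<Rightarrow> bool" where
  "D_exists I \<phi> \<xi>0 \<longleftrightarrow> (\<exists>l. has_D I \<phi> \<xi>0 l)"

definition lim_exists :: "real set \<Rightarrow> (real \<Rightarrow> real) \<Rightarrow> real \<Rightarrow> bool" where
  "lim_exists I \<phi> \<xi>0 \<longleftrightarrow> (\<exists>l. (\<phi> \<longlongrightarrow> l) (at \<xi>0 within I))"

definition has_hderiv ::
    "real set \<Rightarrow> (real \<Rightarrow> real) \<Rightarrow> (hreal \<Rightarrow> hreal) \<Rightarrow> real \<Rightarrow> real \<Rightarrow> bool" where
  "has_hderiv I \<phi> f \<xi>0 \<alpha> \<longleftrightarrow>
     (\<forall>x\<in>monad (hconst \<xi>0). f x = hconst (\<phi> \<xi>0) + hconst \<alpha> * hdiff x) \<and>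
     (\<forall>l. has_D I \<phi> \<xi>0 l \<longrightarrow> \<alpha> = l)"

text \<open>Differentiability is a property of indiscernible extensions only, so the latter is part of it.
  The base function \<open>\<phi>\<close> is an argument because the limit condition refers to it; on \<open>I\<close> it is
  determined by \<open>f\<close>.\<close>

definition hdifferentiable ::
    "real set \<Rightarrow> (real \<Rightarrow> real) \<Rightarrow> (hreal \<Rightarrow> hreal) \<Rightarrow> real \<Rightarrow> bool" where
  "hdifferentiable I \<phi> f \<xi>0 \<longleftrightarrow>
     indisc_ext I \<phi> f \<and> \<xi>0 \<in> I \<and> (\<exists>\<alpha>. has_hderiv I \<phi> f \<xi>0 \<alpha>)"

definition hderiv :: "real set \<Rightarrow> (real \<Rightarrow> real) \<Rightarrow> (hreal \<Rightarrow> hreal) \<Rightarrow> hreal \<Rightarrow> real" where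
  "hderiv I \<phi> f x = (THE \<alpha>. has_hderiv I \<phi> f (hlim x) \<alpha>)"

lemma hseq_tendsto: "hseq x \<longlonglongrightarrow> hlim x"
  using hseq[of x] by (simp add: hlim.rep_eq convergent_LIMSEQ_iff)

lemma hlim_hconst [simp]: "hlim (hconst r) = r"
  by transfer simp

lemma hconst_0 [simp]: "hconst 0 = 0" and hconst_1 [simp]: "hconst 1 = 1"
  by (transfer; simp)+

lemma hconst_add: "hconst (a + b) = hconst a + hconst b"
  by transfer simp

lemma hconst_mult: "hconst (a * b) = hconst a * hconst b"
  by transfer (simp add: fun_eq_iff)

lemma hlim_add: "hlim (x + y) = hlim x + hlim y"
  unfolding hlim.rep_eq[of "x + y"] plus_hreal.rep_eq
  by (intro limI tendsto_add hseq_tendsto)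

lemma hlim_mult: "hlim (x * y) = hlim x * hlim y"
proof -
  have "(\<lambda>n. hlim x * hseq y n + hlim y * hseq x n - hlim x * hlim y)
          \<longlonglongrightarrow> hlim x * hlim y + hlim y * hlim x - hlim x * hlim y"
    by (intro tendsto_intros hseq_tendsto)
  then show ?thesis
    by (simp add: hlim.rep_eq times_hreal.rep_eq limI)
qed

lemma hlim_0 [simp]: "hlim 0 = 0" and hlim_1 [simp]: "hlim 1 = 1"
  by (transfer; simp)+

lemma hlim_diff: "hlim (x - y) = hlim x - hlim y"
  using hlim_add[of "x - y" y] by simp

lemma hlim_hdiff [simp]: "hlim (hdiff x) = 0"
  by (simp add: hdiff_def hlim_diff)

lemma hreal_decomp: "x = hconst (hlim x) + hdiff x"
  by (simp add: hdiff_def)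

lemma infinitesimal_mult: "hlim x = 0 \<Longrightarrow> hlim y = 0 \<Longrightarrow> x * y = 0"
  by transfer (simp add: fun_eq_iff)

lemma hreal_dvd_1_iff: "x dvd 1 \<longleftrightarrow> hlim x \<noteq> 0"
proof
  assume "x dvd 1"
  then obtain y where "1 = x * y" by (rule dvdE)
  then have "1 = hlim x * hlim y" by (metis hlim_1 hlim_mult)
  then show "hlim x \<noteq> 0" by auto
next
  assume nz: "hlim x \<noteq> 0"
  define a where "a = hconst (1 / hlim x)"
  define e where "e = a * hdiff x"
  have ax: "a * x = 1 + e"
    using nz unfolding e_def a_def
    by (subst hreal_decomp) (simp add: distrib_left hconst_mult[symmetric])
  have "e * e = 0"
    by (intro infinitesimal_mult) (simp_all add: e_def hlim_mult)
  moreover have "x * (a * (1 - e)) = (a * x) * (1 - e)" by (simp add: ac_simps)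
  ultimately have "x * (a * (1 - e)) = 1"
    unfolding ax by (simp add: algebra_simps)
  then show "x dvd 1" by (metis dvdI)
qed

lemma mult_inverse_hreal:
  assumes "hlim x \<noteq> 0"
  shows "x * inverse x = 1"
proof -
  from assms obtain y where y: "x * y = 1"
    using hreal_dvd_1_iff by (metis dvdE)
  have "z = y" if "x * z = 1" for z
    using y that by (metis mult.assoc mult.commute mult_1)
  with y have "\<exists>!z. x * z = 1" by blast
  then show ?thesis
    using assms theI'[of "\<lambda>z. x * z = 1"] by (simp add: inverse_hreal_def hinverse_def hreal_dvd_1_iff)
qed

lemma hlim_power: "hlim (x ^ m) = hlim x ^ m"
  by (induction m) (simp_all add: hlim_mult)

lemma hreal_power_Suc:
  "x ^ Suc m = hconst (hlim x ^ Suc m) + hconst (real (Suc m) * hlim x ^ m) * hdiff x"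
proof (induction m)
  case 0
  then show ?case by (simp add: hdiff_def)
next
  case (Suc m)
  have hh: "hdiff x * hdiff x = 0" by (simp add: infinitesimal_mult)
  have "x ^ Suc (Suc m) = (hconst (hlim x) + hdiff x) * x ^ Suc m"
    using hreal_decomp[of x] by simp
  also have "\<dots> = hconst (hlim x ^ Suc (Suc m))
      + (hconst (hlim x * (real (Suc m) * hlim x ^ m)) + hconst (hlim x ^ Suc m)) * hdiff x
      + hconst (real (Suc m) * hlim x ^ m) * (hdiff x * hdiff x)"
    unfolding Suc.IH power_Suc[of "hlim x" "Suc m"]
      hconst_mult[of "hlim x" "hlim x ^ Suc m"] hconst_mult[of "hlim x" "real (Suc m) * hlim x ^ m"]
    by (simp only: distrib_left distrib_right ac_simps)
  also have "\<dots> = hconst (hlim x ^ Suc (Suc m))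
      + hconst (real (Suc (Suc m)) * hlim x ^ Suc m) * hdiff x"
  proof -
    have "hlim x * (real (Suc m) * hlim x ^ m) + hlim x ^ Suc m
            = real (Suc (Suc m)) * hlim x ^ Suc m"
      by (simp add: algebra_simps)
    then show ?thesis unfolding hh hconst_add[symmetric] by simp
  qed
  finally show ?case .
qed

lemma ex1_hroot:
  assumes x: "hless 0 x" and m: "m > 0"
  shows "\<exists>!y. hless 0 y \<and> y ^ m = x"
proof -
  obtain k where k: "m = Suc k" using m by (cases m) auto
  have px: "hlim x > 0" using x by (simp add: hless_def)
  define r where "r = root m (hlim x)"
  have r: "r > 0" "r ^ m = hlim x" using px m by (simp_all add: r_def)
  define c where "c = real m * r ^ k"
  have c: "c \<noteq> 0" using r m by (simp add: c_def)
  define y where "y = hconst r + hconst (1 / c) * hdiff x"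
  have ly: "hlim y = r" by (simp add: y_def hlim_add hlim_mult)
  have hy: "hdiff y = hconst (1 / c) * hdiff x" by (simp add: hdiff_def[of y] ly) (simp add: y_def)
  have "y ^ m = hconst (hlim x) + (hconst c * hconst (1 / c)) * hdiff x"
    unfolding k hreal_power_Suc ly hy using r k by (simp add: c_def mult.assoc)
  also have "\<dots> = x"
    using c by (simp add: hconst_mult[symmetric] hreal_decomp[symmetric])
  finally have ex: "hless 0 y \<and> y ^ m = x" using ly r by (simp add: hless_def)
  have "z = y" if z: "hless 0 z \<and> z ^ m = x" for z
  proof -
    have zp: "hlim z > 0" and zx: "hlim z ^ m = hlim x"
      using z by (auto simp: hless_def hlim_power[symmetric])
    then have lz: "hlim z = r"
      using r m by (metis less_eq_real_def power_eq_imp_eq_base)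
    have "hconst (r ^ m) + hconst c * hdiff z = x"
      using z hreal_power_Suc[of z k] by (simp only: lz k c_def)
    then have "hconst c * hdiff z = hdiff x"
      unfolding hdiff_def[of x] r(2) by (simp add: eq_diff_eq add.commute)
    then have "hconst (1 / c) * (hconst c * hdiff z) = hconst (1 / c) * hdiff x"
      by simp
    then have "hdiff z = hdiff y"
      using c hy by (simp add: mult.assoc[symmetric] hconst_mult[symmetric])
    then show ?thesis
      by (metis hreal_decomp lz ly)
  qed
  with ex show ?thesis by blast
qed

lemma has_hderiv_unique:
  assumes "has_hderiv I \<phi> f \<xi>0 a" "has_hderiv I \<phi> f \<xi>0 b"
  shows "a = b"
proof -
  have conv: "(\<lambda>n. \<xi>0 + inverse (real (Suc n))) \<longlonglongrightarrow> \<xi>0"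
    by (rule LIMSEQ_inverse_real_of_nat_add)
  define x where "x = Abs_hreal (\<lambda>n. \<xi>0 + inverse (real (Suc n)))"
  have sx: "hseq x = (\<lambda>n. \<xi>0 + inverse (real (Suc n)))"
    unfolding x_def using conv by (intro Abs_hreal_inverse) (auto simp: convergent_def)
  have lx: "hlim x = \<xi>0"
    using conv sx by (simp add: hlim.rep_eq limI)
  have "hseq (hdiff x) 0 = 1"
    by (simp add: hdiff_def minus_hreal.rep_eq hconst.rep_eq sx lx)
  moreover have "hlim (hdiff x) = 0" by simp
  ultimately have s: "hseq (hconst c * hdiff x) 0 = c" for c
    by (simp add: times_hreal.rep_eq hlim.rep_eq hconst.rep_eq)
  have "x \<in> monad (hconst \<xi>0)" by (simp add: monad_def indisc_def lx)
  then have "hconst a * hdiff x = hconst b * hdiff x"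
    using assms by (metis has_hderiv_def add_left_cancel)
  then show ?thesis using s by metis
qed

lemma hderiv_eqI:
  assumes "has_hderiv I \<phi> f \<xi>0 \<alpha>" "x \<in> monad (hconst \<xi>0)"
  shows "hderiv I \<phi> f x = \<alpha>"
proof -
  have "hlim x = \<xi>0" using assms(2) by (simp add: monad_def indisc_def)
  then show ?thesis
    unfolding hderiv_def using assms(1) has_hderiv_unique by blast
qed

end

(* The product of two infinitesimals vanishes, so an element of the ring is a dual number
   hlim x + hdiff x and the algebraic part of every rule is first-order expansion. What remains is
   the proviso that the new derivative agrees with the classical one whenever the latter exists;
   in each case the classical derivative of the combined function, if it exists, yields that of an
   original function by undoing the operation (subtracting, dividing by a nonvanishing factor,
   taking powers), which the hypotheses either exclude or turn into the right value. *)

theory Submission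
  imports Defs
begin

section \<open>First-order arithmetic in the ring\<close>

lemma hconst_diff: "hconst (a - b) = hconst a - hconst b"
  by transfer simp

lemma hconst_power: "hconst (a ^ n) = hconst a ^ n"
  by (induction n) (simp_all add: hconst_mult)

text \<open>Infinitesimals are zero divisors, so cancellation is restricted to a non-infinitesimal
  factor, which is a unit.\<close>

lemma hreal_mult_left_cancel:
  fixes x y z :: hreal
  assumes "hlim x \<noteq> 0" "x * y = x * z"
  shows "y = z"
proof -
  have "inverse x * (x * y) = inverse x * (x * z)"
    using assms(2) by simp
  moreover have "inverse x * x = 1"
    using mult_inverse_hreal[OF assms(1)] by (simp add: mult.commute)
  ultimately show ?thesis
    by (simp add: mult.assoc[symmetric])
qed

text \<open>\<open>inverse\<close> is given by a definite description; this reduces computing one to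
  exhibiting a candidate. The equation already makes x a unit, so the default value 0 does not
  arise.\<close>

lemma inverse_hreal_eqI:
  fixes x y :: hreal
  assumes "x * y = 1"
  shows "inverse x = y"
proof -
  have "hlim x \<noteq> 0"
    using assms hreal_dvd_1_iff by (metis dvdI)
  then show ?thesis
    using assms mult_inverse_hreal hreal_mult_left_cancel by metis
qed

lemma divide_hreal_eq: "x / y = x * inverse (y :: hreal)"
  by (simp add: divide_hreal_def inverse_hreal_def)

lemma hconst_mult_hdiff_nilpotent: "hconst a * hdiff x * (hconst b * hdiff x) = 0"
  by (rule infinitesimal_mult) (simp_all add: hlim_mult)

text \<open>Expanding gives one product of two infinitesimals, which is zero. What is left in front
  of \<open>hdiff x\<close> is the coefficient of the product rule.\<close>

lemma first_order_mult:
  "(hconst c + hconst a * hdiff x) * (hconst d + hconst b * hdiff x) =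
     hconst (c * d) + hconst (a * d + b * c) * hdiff x"
proof -
  have "(hconst c + hconst a * hdiff x) * (hconst d + hconst b * hdiff x) =
      hconst c * hconst d + (hconst a * hconst d + hconst b * hconst c) * hdiff x
      + hconst a * hdiff x * (hconst b * hdiff x)"
    by (simp add: algebra_simps)
  then show ?thesis
    by (simp add: hconst_mult_hdiff_nilpotent hconst_mult hconst_add)
qed

text \<open>The coefficient is a times the derivative of 1/t at t = c; it makes the linear term of
  the product vanish.\<close>

lemma first_order_inverse:
  assumes "c \<noteq> 0"
  shows "inverse (hconst c + hconst a * hdiff x) = hconst (1 / c) + hconst (- a / c\<^sup>2) * hdiff x"
proof (rule inverse_hreal_eqI)
  have "a * (1 / c) + - a / c\<^sup>2 * c = 0"
    using assms by (simp add: power2_eq_square)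
  then show "(hconst c + hconst a * hdiff x) * (hconst (1 / c) + hconst (- a / c\<^sup>2) * hdiff x) = 1"
    unfolding first_order_mult using assms by simp
qed

text \<open>The base is treated as one element \<open>y\<close> with limit c and differential
  \<open>hconst a * hdiff x\<close>; expanding \<open>y ^ m\<close> about its own limit gives the
  claim.\<close>

lemma first_order_power:
  assumes "m \<ge> 1"
  shows "(hconst c + hconst a * hdiff x) ^ m =
    hconst (c ^ m) + hconst (real m * c ^ (m - 1) * a) * hdiff x"
proof -
  obtain k where k: "m = Suc k"
    using assms by (cases m) auto
  define y where "y = hconst c + hconst a * hdiff x"
  have y: "hlim y = c"
    by (simp add: y_def hlim_add hlim_mult)
  then have "hdiff y = hconst a * hdiff x"
    by (simp add: hdiff_def[of y]) (simp add: y_def)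
  then show ?thesis
    using y hreal_power_Suc[of y k] unfolding k y_def[symmetric]
    by (simp add: hconst_mult mult.assoc)
qed

text \<open>\<open>hroot 1\<close> is the identity by definition, so m = 1 is split off; otherwise
  uniqueness of positive roots identifies the described element with y.\<close>

lemma hroot_eqI:
  assumes "m \<ge> 1" "hlim y > 0" "y ^ m = x"
  shows "hroot m x = y"
proof (cases "m = 1")
  case True
  then show ?thesis
    using assms by (simp add: hroot_def)
next
  case False
  have "hless 0 x"
    using assms by (auto simp: hless_def hlim_power)
  then have "\<exists>!y. hless 0 y \<and> y ^ m = x"
    using ex1_hroot assms(1) by simp
  then show ?thesis
    using False assms(2,3) by (auto simp: hroot_def hless_def intro: the1_equality)
qed

text \<open>With r for \<open>root m c\<close>, the expansion of an m-th power turns the condition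
  on the linear coefficient b into m * r^(m-1) * b = a; the stated coefficient is its
  solution.\<close>

lemma first_order_hroot:
  assumes "m \<ge> 1" "c > 0"
  shows "hroot m (hconst c + hconst a * hdiff x) =
    hconst (root m c) + hconst (a / (real m * root m c ^ (m - 1))) * hdiff x"
proof (rule hroot_eqI)
  have r: "root m c > 0" "root m c ^ m = c"
    using assms by simp_all
  then show "0 < hlim (hconst (root m c) + hconst (a / (real m * root m c ^ (m - 1))) * hdiff x)"
    by (simp add: hlim_add hlim_mult)
  show "(hconst (root m c) + hconst (a / (real m * root m c ^ (m - 1))) * hdiff x) ^ m =
    hconst c + hconst a * hdiff x"
    unfolding first_order_power[OF assms(1)] using r assms by simp
qed (fact assms(1))

lemma hroot_hconst: "m \<ge> 1 \<Longrightarrow> c > 0 \<Longrightarrow> hroot m (hconst c) = hconst (root m c)"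
  using first_order_hroot[of m c 0] by simp

lemma hlim_inverse:
  assumes "hlim x \<noteq> 0"
  shows "hlim (inverse x) = 1 / hlim x"
proof -
  have "hlim x * hlim (inverse x) = 1"
    using mult_inverse_hreal[OF assms] by (metis hlim_mult hlim_1)
  then show ?thesis
    using assms by (simp add: field_simps)
qed

lemma inverse_hconst: "c \<noteq> 0 \<Longrightarrow> inverse (hconst c) = hconst (1 / c)"
  by (rule inverse_hreal_eqI) (simp add: hconst_mult[symmetric])

lemma hlim_hroot:
  assumes "m \<ge> 1" "hlim x > 0"
  shows "hlim (hroot m x) = root m (hlim x)"
  \<comment> \<open>With constant term \<open>hlim x\<close> and coefficient 1, the expanded
    argument is x itself.\<close>
  using first_order_hroot[OF assms, of 1 x]
  by (simp add: hreal_decomp[symmetric] hlim_add hlim_mult)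

section \<open>Monads, extensions and derivatives in terms of limits\<close>

lemma mem_monad_hconst_iff: "x \<in> monad (hconst \<xi>) \<longleftrightarrow> hlim x = \<xi>"
  by (simp add: monad_def indisc_def)

lemma indisc_ext_iff:
  "indisc_ext I \<phi> f \<longleftrightarrow>
     (\<forall>x. hlim x \<in> I \<longrightarrow> f (hconst (hlim x)) = hconst (\<phi> (hlim x)) \<and> hlim (f x) = \<phi> (hlim x))"
  by (auto simp: indisc_ext_def monad_set_def mem_monad_hconst_iff indisc_def)

lemma indisc_ext_hconst: "indisc_ext I \<phi> f \<Longrightarrow> \<xi> \<in> I \<Longrightarrow> f (hconst \<xi>) = hconst (\<phi> \<xi>)"
  unfolding indisc_ext_iff by (metis hlim_hconst)

lemma has_hderiv_iff:
  "has_hderiv I \<phi> f \<xi> \<alpha> \<longleftrightarrow>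
     (\<forall>x. hlim x = \<xi> \<longrightarrow> f x = hconst (\<phi> \<xi>) + hconst \<alpha> * hdiff x) \<and>
     (\<forall>l. has_D I \<phi> \<xi> l \<longrightarrow> \<alpha> = l)"
  by (auto simp: has_hderiv_def mem_monad_hconst_iff)

lemma has_hderivI:
  assumes "\<And>x. hlim x = \<xi> \<Longrightarrow> f x = hconst (\<phi> \<xi>) + hconst \<alpha> * hdiff x"
    and "\<And>l. has_D I \<phi> \<xi> l \<Longrightarrow> \<alpha> = l"
  shows "has_hderiv I \<phi> f \<xi> \<alpha>"
  using assms by (simp add: has_hderiv_iff)

lemma has_hderiv_expand:
  "has_hderiv I \<phi> f \<xi> \<alpha> \<Longrightarrow> hlim x = \<xi> \<Longrightarrow> f x = hconst (\<phi> \<xi>) + hconst \<alpha> * hdiff x"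
  by (simp add: has_hderiv_iff)

lemma has_hderiv_has_D: "has_hderiv I \<phi> f \<xi> \<alpha> \<Longrightarrow> has_D I \<phi> \<xi> l \<Longrightarrow> l = \<alpha>"
  by (simp add: has_hderiv_iff)

text \<open>Each rule of the theorem comes down to two facts: the combined function is an
  indiscernible extension, and it has the right coefficient in \<open>has_hderiv\<close>.\<close>

lemma hdifferentiable_hderiv:
  assumes "indisc_ext I \<phi> f" "\<xi> \<in> I" "has_hderiv I \<phi> f \<xi> \<alpha>"
  shows "hdifferentiable I \<phi> f \<xi> \<and> (\<forall>x\<in>monad (hconst \<xi>). hderiv I \<phi> f x = \<alpha>)"
  unfolding hdifferentiable_def using assms hderiv_eqI[OF assms(3)] by blast

text \<open>\<open>hderiv\<close> sees its argument only through the limit.\<close>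

lemma hderiv_monad: "x \<in> monad (hconst \<xi>) \<Longrightarrow> hderiv I \<phi> f x = hderiv I \<phi> f (hconst \<xi>)"
  by (simp add: hderiv_def mem_monad_hconst_iff)

lemma hdifferentiable_has_hderiv:
  "hdifferentiable I \<phi> f \<xi> \<Longrightarrow> has_hderiv I \<phi> f \<xi> (hderiv I \<phi> f (hconst \<xi>))"
  unfolding hdifferentiable_def using hderiv_eqI[of I \<phi> f \<xi> _ "hconst \<xi>"]
  by (auto simp: mem_monad_hconst_iff)

section \<open>Classical derivatives within I\<close>

lemma has_D_iff: "has_D I \<phi> \<xi> l \<longleftrightarrow> (\<phi> has_field_derivative l) (at \<xi> within I)"
  by (simp add: has_D_def has_field_derivative_iff)

text \<open>At a point of an open set the limit within I is the ordinary two-sided one, where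
  derivatives are unique.\<close>

lemma has_D_unique:
  assumes "open I" "\<xi> \<in> I" "has_D I \<phi> \<xi> l" "has_D I \<phi> \<xi> l'"
  shows "l = l'"
  using assms(3,4) DERIV_unique unfolding has_D_iff at_within_open[OF assms(2,1)] by blast

lemma has_D_cong:
  assumes "\<And>\<xi>. \<xi> \<in> I \<Longrightarrow> \<phi> \<xi> = \<psi> \<xi>" "\<xi> \<in> I"
  shows "has_D I \<phi> \<xi> l \<longleftrightarrow> has_D I \<psi> \<xi> l"
  unfolding has_D_iff by (rule has_field_derivative_cong_eventually)
    (use assms in \<open>auto simp: eventually_at_filter\<close>)

lemma has_D_diff:
  "has_D I \<phi> \<xi> a \<Longrightarrow> has_D I \<psi> \<xi> b \<Longrightarrow> has_D I (\<lambda>\<xi>. \<phi> \<xi> - \<psi> \<xi>) \<xi> (a - b)"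
  unfolding has_D_iff by (rule DERIV_diff)

lemma has_D_mult:
  "has_D I \<phi> \<xi> a \<Longrightarrow> has_D I \<psi> \<xi> b \<Longrightarrow> has_D I (\<lambda>\<xi>. \<phi> \<xi> * \<psi> \<xi>) \<xi> (a * \<psi> \<xi> + b * \<phi> \<xi>)"
  unfolding has_D_iff by (rule DERIV_mult)

lemma has_D_inverse:
  assumes "has_D I \<phi> \<xi> a" "\<phi> \<xi> \<noteq> 0"
  shows "has_D I (\<lambda>\<xi>. 1 / \<phi> \<xi>) \<xi> (- a / (\<phi> \<xi>)\<^sup>2)"
  using assms(1) unfolding has_D_iff
  by (auto intro!: derivative_eq_intros simp: assms(2) power2_eq_square)

lemma has_D_power:
  "has_D I \<phi> \<xi> a \<Longrightarrow> has_D I (\<lambda>\<xi>. \<phi> \<xi> ^ m) \<xi> (real m * \<phi> \<xi> ^ (m - 1) * a)"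
  unfolding has_D_iff using DERIV_power[of \<phi> a \<xi> I m] by (simp add: mult_ac)

lemma has_D_tendsto:
  assumes "has_D I \<phi> \<xi> a"
  shows "(\<phi> \<longlongrightarrow> \<phi> \<xi>) (at \<xi> within I)"
  using assms DERIV_continuous unfolding has_D_iff continuous_within by blast

text \<open>Multiplying the product by 1/\<phi> recovers \<psi>. Differentiability makes \<phi>
  continuous at \<xi>, so \<phi> stays nonzero near \<xi> and the recovered function agrees with
  \<psi> there.\<close>

lemma D_exists_cancel_mult:
  assumes "has_D I \<phi> \<xi> a" "\<phi> \<xi> \<noteq> 0" "D_exists I (\<lambda>\<xi>. \<phi> \<xi> * \<psi> \<xi>) \<xi>"
  shows "D_exists I \<psi> \<xi>"
proof -
  obtain l where "has_D I (\<lambda>\<xi>. \<phi> \<xi> * \<psi> \<xi>) \<xi> l"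
    using assms(3) by (auto simp: D_exists_def)
  from has_D_mult[OF this has_D_inverse[OF assms(1,2)]] obtain b
    where "has_D I (\<lambda>\<xi>. \<phi> \<xi> * \<psi> \<xi> * (1 / \<phi> \<xi>)) \<xi> b"
    by blast
  moreover have "\<forall>\<^sub>F \<xi> in at \<xi> within I. \<phi> \<xi> \<noteq> 0"
    using tendsto_imp_eventually_ne[OF has_D_tendsto[OF assms(1)] assms(2)] .
  then have "\<forall>\<^sub>F \<xi> in at \<xi> within I. \<phi> \<xi> * \<psi> \<xi> * (1 / \<phi> \<xi>) = \<psi> \<xi>"
    by eventually_elim simp
  ultimately have "has_D I \<psi> \<xi> b"
    unfolding has_D_iff using assms(2) by (subst (asm) has_field_derivative_cong_eventually) auto
  then show ?thesis
    by (auto simp: D_exists_def)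
qed

text \<open>A difference of m-th powers is the difference of the bases times a sum \<open>S\<close>.
  By continuity \<open>S\<close> tends to m * \<phi>(\<xi>)^(m-1), which is nonzero, so dividing the
  difference quotient of the power by \<open>S\<close> leaves that of \<phi>. This treats all signs
  of \<phi>(\<xi>) and all parities of m alike.\<close>

lemma D_exists_cancel_power:
  assumes "continuous (at \<xi> within I) \<phi>" "\<phi> \<xi> \<noteq> 0" "m \<ge> 1" "D_exists I (\<lambda>\<xi>. \<phi> \<xi> ^ m) \<xi>"
  shows "D_exists I \<phi> \<xi>"
proof -
  define S where "S = (\<lambda>t. \<Sum>i<m. \<phi> \<xi> ^ (m - Suc i) * \<phi> t ^ i)"
  have factor: "\<phi> t ^ m - \<phi> \<xi> ^ m = (\<phi> t - \<phi> \<xi>) * S t" for t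
    unfolding S_def by (rule power_diff_sumr2)
  have "(\<phi> \<longlongrightarrow> \<phi> \<xi>) (at \<xi> within I)"
    using assms(1) by (simp add: continuous_within)
  then have "(S \<longlongrightarrow> (\<Sum>i<m. \<phi> \<xi> ^ (m - Suc i) * \<phi> \<xi> ^ i)) (at \<xi> within I)"
    unfolding S_def by (intro tendsto_intros)
  \<comment> \<open>For i < m the two exponents add up to m - 1.\<close>
  also have "(\<Sum>i<m. \<phi> \<xi> ^ (m - Suc i) * \<phi> \<xi> ^ i) = (\<Sum>i<m. \<phi> \<xi> ^ (m - 1))"
    by (intro sum.cong refl) (simp add: power_add[symmetric])
  finally have S: "(S \<longlongrightarrow> real m * \<phi> \<xi> ^ (m - 1)) (at \<xi> within I)"
    by simp
  have nz: "real m * \<phi> \<xi> ^ (m - 1) \<noteq> 0"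
    using assms(2,3) by simp
  obtain l where "((\<lambda>t. (\<phi> t ^ m - \<phi> \<xi> ^ m) / (t - \<xi>)) \<longlongrightarrow> l) (at \<xi> within I)"
    using assms(4) by (auto simp: D_exists_def has_D_def)
  from tendsto_divide[OF this S nz]
  have "((\<lambda>t. (\<phi> t ^ m - \<phi> \<xi> ^ m) / (t - \<xi>) / S t)
     \<longlongrightarrow> l / (real m * \<phi> \<xi> ^ (m - 1))) (at \<xi> within I)" .
  moreover have "\<forall>\<^sub>F t in at \<xi> within I.
      (\<phi> t ^ m - \<phi> \<xi> ^ m) / (t - \<xi>) / S t = (\<phi> t - \<phi> \<xi>) / (t - \<xi>)"
    using tendsto_imp_eventually_ne[OF S nz] by eventually_elim (simp add: factor)
  ultimately have "((\<lambda>t. (\<phi> t - \<phi> \<xi>) / (t - \<xi>)) \<longlongrightarrow> l / (real m * \<phi> \<xi> ^ (m - 1))) (at \<xi> within I)"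
    by (rule Lim_transform_eventually)
  then show ?thesis
    by (auto simp: D_exists_def has_D_def)
qed

section \<open>Affine functions\<close>

lemma has_hderiv_affine:
  assumes "open I" "\<xi> \<in> I" "indisc_ext I \<phi> f"
    and f: "\<And>x. hlim x \<in> I \<Longrightarrow> f x = hconst \<alpha> * x + hconst \<beta>"
  shows "has_hderiv I \<phi> f \<xi> \<alpha>"
proof -
  \<comment> \<open>The formula is assumed for f; evaluating at constant sequences passes it on to
    \<phi>, to which the proviso refers.\<close>
  have \<phi>: "\<phi> t = \<alpha> * t + \<beta>" if "t \<in> I" for t
  proof -
    have "hlim (f (hconst t)) = \<alpha> * t + \<beta>"
      using f[of "hconst t"] that by (simp add: hlim_add hlim_mult)
    then show ?thesis
      using that assms(3) by (simp add: indisc_ext_hconst)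
  qed
  show ?thesis
  proof (rule has_hderivI)
    fix x assume x: "hlim x = \<xi>"
    have "f x = hconst \<alpha> * (hconst \<xi> + hdiff x) + hconst \<beta>"
      using f[of x] x assms(2) hreal_decomp[of x] by simp
    then show "f x = hconst (\<phi> \<xi>) + hconst \<alpha> * hdiff x"
      by (simp add: \<phi>[OF assms(2)] hconst_add hconst_mult algebra_simps)
  next
    fix l assume "has_D I \<phi> \<xi> l"
    then have "has_D I (\<lambda>t. \<alpha> * t + \<beta>) \<xi> l"
      using has_D_cong[of I \<phi> "\<lambda>t. \<alpha> * t + \<beta>"] \<phi> assms(2) by simp
    moreover have "has_D I (\<lambda>t. \<alpha> * t + \<beta>) \<xi> \<alpha>"
      unfolding has_D_iff by (auto intro!: derivative_eq_intros)
    ultimately show "\<alpha> = l"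
      using has_D_unique[OF assms(1,2)] by blast
  qed
qed

section \<open>Extension property of sums, products, reciprocals, powers and roots\<close>

lemma indisc_ext_add:
  "indisc_ext I \<phi> f \<Longrightarrow> indisc_ext I \<psi> g \<Longrightarrow> indisc_ext I (\<lambda>\<xi>. \<phi> \<xi> + \<psi> \<xi>) (\<lambda>x. f x + g x)"
  by (simp add: indisc_ext_iff hconst_add hlim_add)

lemma indisc_ext_mult:
  "indisc_ext I \<phi> f \<Longrightarrow> indisc_ext I \<psi> g \<Longrightarrow> indisc_ext I (\<lambda>\<xi>. \<phi> \<xi> * \<psi> \<xi>) (\<lambda>x. f x * g x)"
  by (simp add: indisc_ext_iff hconst_mult hlim_mult)

lemma indisc_ext_inverse:
  "indisc_ext I \<psi> g \<Longrightarrow> (\<And>\<xi>. \<xi> \<in> I \<Longrightarrow> \<psi> \<xi> \<noteq> 0) \<Longrightarrow>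
    indisc_ext I (\<lambda>\<xi>. 1 / \<psi> \<xi>) (\<lambda>x. inverse (g x))"
  by (simp add: indisc_ext_iff inverse_hconst hlim_inverse)

lemma indisc_ext_power: "indisc_ext I \<phi> f \<Longrightarrow> indisc_ext I (\<lambda>\<xi>. \<phi> \<xi> ^ m) (\<lambda>x. f x ^ m)"
  by (simp add: indisc_ext_iff hconst_power hlim_power)

lemma indisc_ext_hroot:
  "indisc_ext I \<phi> f \<Longrightarrow> (\<And>\<xi>. \<xi> \<in> I \<Longrightarrow> \<phi> \<xi> > 0) \<Longrightarrow> m \<ge> 1 \<Longrightarrow>
    indisc_ext I (\<lambda>\<xi>. root m (\<phi> \<xi>)) (\<lambda>x. hroot m (f x))"
  by (simp add: indisc_ext_iff hroot_hconst hlim_hroot)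

section \<open>Differentiation rules with their provisos\<close>

lemma has_hderiv_add:
  assumes f: "has_hderiv I \<phi> f \<xi> a" and g: "has_hderiv I \<psi> g \<xi> b"
    and "D_exists I \<phi> \<xi> \<or> D_exists I \<psi> \<xi>"
  shows "has_hderiv I (\<lambda>\<xi>. \<phi> \<xi> + \<psi> \<xi>) (\<lambda>x. f x + g x) \<xi> (a + b)"
proof (rule has_hderivI)
  fix x assume "hlim x = \<xi>"
  then show "f x + g x = hconst (\<phi> \<xi> + \<psi> \<xi>) + hconst (a + b) * hdiff x"
    using has_hderiv_expand[OF f] has_hderiv_expand[OF g]
    by (simp add: hconst_add algebra_simps)
next
  fix l assume l: "has_D I (\<lambda>\<xi>. \<phi> \<xi> + \<psi> \<xi>) \<xi> l"
  \<comment> \<open>One summand has a classical derivative, whose value its own proviso fixes.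
    Subtracting it from l gives a classical derivative of the other summand, and the proviso for
    that one yields a + b = l.\<close>
  consider "has_D I \<phi> \<xi> a" | "has_D I \<psi> \<xi> b"
    using assms has_hderiv_has_D unfolding D_exists_def by blast
  then show "a + b = l"
  proof cases
    case 1
    then have "has_D I \<psi> \<xi> (l - a)"
      using has_D_diff[OF l 1] by simp
    then show ?thesis
      using has_hderiv_has_D[OF g] by force
  next
    case 2
    then have "has_D I \<phi> \<xi> (l - b)"
      using has_D_diff[OF l 2] by simp
    then show ?thesis
      using has_hderiv_has_D[OF f] by force
  qed
qed

text \<open>For the proviso, either both classical derivatives are given, or \<phi>(\<xi>) is
  nonzero and dividing the product by \<phi> makes \<psi> differentiable. The classical product rule
  and uniqueness then decide the value.\<close>

lemma has_hderiv_mult_aux: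
  assumes I: "open I" "\<xi> \<in> I"
    and f: "has_hderiv I \<phi> f \<xi> a" and g: "has_hderiv I \<psi> g \<xi> b"
    and D: "D_exists I \<phi> \<xi>" "D_exists I \<psi> \<xi> \<or> \<phi> \<xi> \<noteq> 0"
  shows "has_hderiv I (\<lambda>\<xi>. \<phi> \<xi> * \<psi> \<xi>) (\<lambda>x. f x * g x) \<xi> (a * \<psi> \<xi> + b * \<phi> \<xi>)"
proof (rule has_hderivI)
  fix x assume "hlim x = \<xi>"
  then show "f x * g x = hconst (\<phi> \<xi> * \<psi> \<xi>) + hconst (a * \<psi> \<xi> + b * \<phi> \<xi>) * hdiff x"
    using has_hderiv_expand[OF f] has_hderiv_expand[OF g] by (simp add: first_order_mult)
next
  fix l assume l: "has_D I (\<lambda>\<xi>. \<phi> \<xi> * \<psi> \<xi>) \<xi> l"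
  have a: "has_D I \<phi> \<xi> a"
    using D(1) has_hderiv_has_D[OF f] by (auto simp: D_exists_def)
  then have "D_exists I \<psi> \<xi>"
    using D(2) D_exists_cancel_mult[OF a] l by (auto simp: D_exists_def)
  then have "has_D I \<psi> \<xi> b"
    using has_hderiv_has_D[OF g] by (auto simp: D_exists_def)
  from has_D_unique[OF I has_D_mult[OF a this] l]
  show "a * \<psi> \<xi> + b * \<phi> \<xi> = l" .
qed

text \<open>The asymmetric version is applied to either order of the factors. The disjunction fits
  the cases of the product and, with 1/\<psi> in place of \<psi>, those of the quotient.\<close>

lemma has_hderiv_mult:
  assumes I: "open I" "\<xi> \<in> I"
    and f: "has_hderiv I \<phi> f \<xi> a" and g: "has_hderiv I \<psi> g \<xi> b"
    and D: "D_exists I \<phi> \<xi> \<and> D_exists I \<psi> \<xi> \<or> D_exists I \<phi> \<xi> \<and> \<phi> \<xi> \<noteq> 0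
      \<or> D_exists I \<psi> \<xi> \<and> \<psi> \<xi> \<noteq> 0"
  shows "has_hderiv I (\<lambda>\<xi>. \<phi> \<xi> * \<psi> \<xi>) (\<lambda>x. f x * g x) \<xi> (a * \<psi> \<xi> + b * \<phi> \<xi>)"
proof (cases "D_exists I \<phi> \<xi> \<and> (D_exists I \<psi> \<xi> \<or> \<phi> \<xi> \<noteq> 0)")
  case True
  then show ?thesis
    using has_hderiv_mult_aux[OF I f g] by blast
next
  case False
  then have "D_exists I \<psi> \<xi>" "D_exists I \<phi> \<xi> \<or> \<psi> \<xi> \<noteq> 0"
    using D by auto
  from has_hderiv_mult_aux[OF I g f this] show ?thesis
    by (simp add: mult.commute[of "\<psi> _" "\<phi> _"] mult.commute[of "g _" "f _"] add.commute)
qed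

text \<open>Reciprocation undoes itself: a classical derivative of 1/\<psi> yields one of \<psi>, so
  the proviso for g determines l.\<close>

lemma has_hderiv_inverse:
  assumes g: "has_hderiv I \<psi> g \<xi> b" and nz: "\<psi> \<xi> \<noteq> 0"
  shows "has_hderiv I (\<lambda>\<xi>. 1 / \<psi> \<xi>) (\<lambda>x. inverse (g x)) \<xi> (- b / (\<psi> \<xi>)\<^sup>2)"
proof (rule has_hderivI)
  fix x assume "hlim x = \<xi>"
  then show "inverse (g x) = hconst (1 / \<psi> \<xi>) + hconst (- b / (\<psi> \<xi>)\<^sup>2) * hdiff x"
    using has_hderiv_expand[OF g] first_order_inverse[OF nz] by simp
next
  fix l assume "has_D I (\<lambda>\<xi>. 1 / \<psi> \<xi>) \<xi> l"
  \<comment> \<open>Here \<psi> is known to be nonzero only at \<xi>; still 1 / (1 / \<psi> t) =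
    \<psi> t for every t, since division by zero gives zero.\<close>
  from has_D_inverse[OF this] nz have "has_D I \<psi> \<xi> (- l * (\<psi> \<xi>)\<^sup>2)"
    by (simp add: power_divide)
  from has_hderiv_has_D[OF g this] show "- b / (\<psi> \<xi>)\<^sup>2 = l"
    using nz by (simp add: field_simps)
qed

text \<open>In the continuous case a classical derivative of the power gives one of \<phi> by
  \<open>D_exists_cancel_power\<close>, so the classical power rule always decides the
  proviso.\<close>

lemma has_hderiv_power:
  assumes I: "open I" "\<xi> \<in> I" and f: "has_hderiv I \<phi> f \<xi> a" and m: "m \<ge> 1"
    and D: "D_exists I \<phi> \<xi> \<or> continuous (at \<xi> within I) \<phi> \<and> \<phi> \<xi> \<noteq> 0"
  shows "has_hderiv I (\<lambda>\<xi>. \<phi> \<xi> ^ m) (\<lambda>x. f x ^ m) \<xi> (real m * \<phi> \<xi> ^ (m - 1) * a)"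
proof (rule has_hderivI)
  fix x assume "hlim x = \<xi>"
  then show "f x ^ m = hconst (\<phi> \<xi> ^ m) + hconst (real m * \<phi> \<xi> ^ (m - 1) * a) * hdiff x"
    using has_hderiv_expand[OF f] first_order_power[OF m] by simp
next
  fix l assume l: "has_D I (\<lambda>\<xi>. \<phi> \<xi> ^ m) \<xi> l"
  then have "D_exists I \<phi> \<xi>"
    using D D_exists_cancel_power[OF _ _ m, of \<xi> I \<phi>] by (auto simp: D_exists_def)
  then have "has_D I \<phi> \<xi> a"
    using has_hderiv_has_D[OF f] by (auto simp: D_exists_def)
  from has_D_unique[OF I has_D_power[OF this] l]
  show "real m * \<phi> \<xi> ^ (m - 1) * a = l" .
qed

text \<open>The m-th power of the root is \<phi> on I, so a classical derivative l of the root gives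
  \<phi> the derivative m * r^(m-1) * l with r = \<open>root m (\<phi> \<xi>)\<close>. The proviso
  for f equates this with a, and r > 0 allows solving for l.\<close>

lemma has_hderiv_hroot:
  assumes I: "\<xi> \<in> I" and f: "has_hderiv I \<phi> f \<xi> a" and m: "m \<ge> 1"
    and pos: "\<And>\<xi>. \<xi> \<in> I \<Longrightarrow> \<phi> \<xi> > 0"
  shows "has_hderiv I (\<lambda>\<xi>. root m (\<phi> \<xi>)) (\<lambda>x. hroot m (f x)) \<xi>
    (a / (real m * root m (\<phi> \<xi>) ^ (m - 1)))"
proof (rule has_hderivI)
  fix x assume x: "hlim x = \<xi>"
  show "hroot m (f x) =
    hconst (root m (\<phi> \<xi>)) + hconst (a / (real m * root m (\<phi> \<xi>) ^ (m - 1))) * hdiff x"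
    unfolding has_hderiv_expand[OF f x] by (rule first_order_hroot[OF m pos[OF I]])
next
  fix l assume "has_D I (\<lambda>\<xi>. root m (\<phi> \<xi>)) \<xi> l"
  from has_D_power[OF this, of m]
  have "has_D I (\<lambda>\<xi>. root m (\<phi> \<xi>) ^ m) \<xi> (real m * root m (\<phi> \<xi>) ^ (m - 1) * l)" .
  moreover have "root m (\<phi> t) ^ m = \<phi> t" if "t \<in> I" for t
    using pos[OF that] m by simp
  ultimately have "has_D I \<phi> \<xi> (real m * root m (\<phi> \<xi>) ^ (m - 1) * l)"
    using has_D_cong[of I "\<lambda>\<xi>. root m (\<phi> \<xi>) ^ m" \<phi>] I by simp
  from has_hderiv_has_D[OF f this] have "real m * root m (\<phi> \<xi>) ^ (m - 1) * l = a" .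
  moreover have "real m * root m (\<phi> \<xi>) ^ (m - 1) \<noteq> 0"
    using pos[OF I] m by simp
  ultimately show "a / (real m * root m (\<phi> \<xi>) ^ (m - 1)) = l"
    by (metis nonzero_mult_div_cancel_left)
qed

section \<open>The six rules for functions on the monad of an open interval\<close>

theorem proposition5p22:
  fixes I :: "real set" and \<phi> \<psi> :: "real \<Rightarrow> real" and f g :: "hreal \<Rightarrow> hreal" and \<xi>0 :: real
  assumes "open I" and "is_interval I"
    and "indisc_ext I \<phi> f" and "indisc_ext I \<psi> g"
    and "\<xi>0 \<in> I"
  shows "(\<forall>\<alpha> \<beta> :: real. (\<forall>x\<in>monad_set (hconst ` I). f x = hconst \<alpha> * x + hconst \<beta>) \<longrightarrow>
       hdifferentiable I \<phi> f \<xi>0 \<and> (\<forall>x\<in>monad (hconst \<xi>0). hderiv I \<phi> f x = \<alpha>)) \<and>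
     (hdifferentiable I \<phi> f \<xi>0 \<and> hdifferentiable I \<psi> g \<xi>0 \<and>
       (D_exists I \<phi> \<xi>0 \<or> D_exists I \<psi> \<xi>0) \<longrightarrow>
       hdifferentiable I (\<lambda>\<xi>. \<phi> \<xi> + \<psi> \<xi>) (\<lambda>x. f x + g x) \<xi>0 \<and>
       (\<forall>x\<in>monad (hconst \<xi>0).
          hderiv I (\<lambda>\<xi>. \<phi> \<xi> + \<psi> \<xi>) (\<lambda>x. f x + g x) x = hderiv I \<phi> f x + hderiv I \<psi> g x)) \<and>
     (hdifferentiable I \<phi> f \<xi>0 \<and> hdifferentiable I \<psi> g \<xi>0 \<and>
       ((D_exists I \<phi> \<xi>0 \<and> D_exists I \<psi> \<xi>0) \<or>
        (\<phi> \<xi>0 \<noteq> 0 \<and> D_exists I \<phi> \<xi>0 \<and> lim_exists I \<psi> \<xi>0 \<and> \<not> D_exists I \<psi> \<xi>0) \<or>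
        (\<psi> \<xi>0 \<noteq> 0 \<and> D_exists I \<psi> \<xi>0 \<and> lim_exists I \<phi> \<xi>0 \<and> \<not> D_exists I \<phi> \<xi>0)) \<longrightarrow>
       hdifferentiable I (\<lambda>\<xi>. \<phi> \<xi> * \<psi> \<xi>) (\<lambda>x. f x * g x) \<xi>0 \<and>
       (\<forall>x\<in>monad (hconst \<xi>0).
          hconst (hderiv I (\<lambda>\<xi>. \<phi> \<xi> * \<psi> \<xi>) (\<lambda>x. f x * g x) x) =
            hconst (hderiv I \<phi> f x) * g (hconst \<xi>0) + hconst (hderiv I \<psi> g x) * f (hconst \<xi>0))) \<and>
     (hdifferentiable I \<phi> f \<xi>0 \<and> hdifferentiable I \<psi> g \<xi>0 \<and> (\<forall>\<xi>\<in>I. \<psi> \<xi> \<noteq> 0) \<and>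
       ((D_exists I \<phi> \<xi>0 \<and> D_exists I \<psi> \<xi>0) \<or>
        (\<phi> \<xi>0 \<noteq> 0 \<and> D_exists I \<phi> \<xi>0 \<and> lim_exists I (\<lambda>\<xi>. 1 / \<psi> \<xi>) \<xi>0 \<and>
           \<not> D_exists I (\<lambda>\<xi>. 1 / \<psi> \<xi>) \<xi>0) \<or>
        (D_exists I (\<lambda>\<xi>. 1 / \<psi> \<xi>) \<xi>0 \<and> lim_exists I \<phi> \<xi>0 \<and> \<not> D_exists I \<phi> \<xi>0)) \<longrightarrow>
       hdifferentiable I (\<lambda>\<xi>. \<phi> \<xi> / \<psi> \<xi>) (\<lambda>x. f x / g x) \<xi>0 \<and>
       (\<forall>x\<in>monad (hconst \<xi>0).
          hconst (hderiv I (\<lambda>\<xi>. \<phi> \<xi> / \<psi> \<xi>) (\<lambda>x. f x / g x) x) =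
            (hconst (hderiv I \<phi> f x) * g (hconst \<xi>0) - hconst (hderiv I \<psi> g x) * f (hconst \<xi>0))
              / (g (hconst \<xi>0)) ^ 2)) \<and>
     (\<forall>m::nat. m \<ge> 1 \<and> hdifferentiable I \<phi> f \<xi>0 \<and>
       (D_exists I \<phi> \<xi>0 \<or>
        (continuous (at \<xi>0 within I) \<phi> \<and> \<phi> \<xi>0 \<noteq> 0 \<and> \<not> D_exists I \<phi> \<xi>0)) \<longrightarrow>
       hdifferentiable I (\<lambda>\<xi>. \<phi> \<xi> ^ m) (\<lambda>x. f x ^ m) \<xi>0 \<and>
       (\<forall>x\<in>monad (hconst \<xi>0).
          hconst (hderiv I (\<lambda>\<xi>. \<phi> \<xi> ^ m) (\<lambda>x. f x ^ m) x) =
            hconst (real m) * f (hconst \<xi>0) ^ (m - 1) * hconst (hderiv I \<phi> f x))) \<and>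
     (\<forall>m::nat. m \<ge> 1 \<and> hdifferentiable I \<phi> f \<xi>0 \<and> (\<forall>\<xi>\<in>I. \<phi> \<xi> > 0) \<longrightarrow>
       hdifferentiable I (\<lambda>\<xi>. root m (\<phi> \<xi>)) (\<lambda>x. hroot m (f x)) \<xi>0 \<and>
       (\<forall>x\<in>monad (hconst \<xi>0).
          hconst (hderiv I (\<lambda>\<xi>. root m (\<phi> \<xi>)) (\<lambda>x. hroot m (f x)) x) =
            hconst (hderiv I \<phi> f x) / (hconst (real m) * hroot m (f (hconst \<xi>0) ^ (m - 1)))))"
proof -
  note I = \<open>open I\<close> \<open>\<xi>0 \<in> I\<close>
  note ext_f = \<open>indisc_ext I \<phi> f\<close> and ext_g = \<open>indisc_ext I \<psi> g\<close>
  note f\<xi>0 = indisc_ext_hconst[OF ext_f I(2)] and g\<xi>0 = indisc_ext_hconst[OF ext_g I(2)]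
  note differentiable = hdifferentiable_hderiv[OF _ I(2)]
  \<comment> \<open>Derivatives are constant on the monad of \<xi>0, so these two reals stand for
    them throughout.\<close>
  define a where "a = hderiv I \<phi> f (hconst \<xi>0)"
  define b where "b = hderiv I \<psi> g (hconst \<xi>0)"
  have a: "hderiv I \<phi> f x = a" and b: "hderiv I \<psi> g x = b" if "x \<in> monad (hconst \<xi>0)" for x
    using hderiv_monad[OF that] by (simp_all add: a_def b_def)
  have part_a: "\<forall>\<alpha> \<beta> :: real. (\<forall>x\<in>monad_set (hconst ` I). f x = hconst \<alpha> * x + hconst \<beta>) \<longrightarrow>
       hdifferentiable I \<phi> f \<xi>0 \<and> (\<forall>x\<in>monad (hconst \<xi>0). hderiv I \<phi> f x = \<alpha>)"
  proof (intro allI impI)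
    fix \<alpha> \<beta> :: real
    assume "\<forall>x\<in>monad_set (hconst ` I). f x = hconst \<alpha> * x + hconst \<beta>"
    then have "f x = hconst \<alpha> * x + hconst \<beta>" if "hlim x \<in> I" for x
      using that by (auto simp: monad_set_def mem_monad_hconst_iff)
    from differentiable[OF ext_f has_hderiv_affine[OF I ext_f this]]
    show "hdifferentiable I \<phi> f \<xi>0 \<and> (\<forall>x\<in>monad (hconst \<xi>0). hderiv I \<phi> f x = \<alpha>)" .
  qed
  have part_b: "hdifferentiable I \<phi> f \<xi>0 \<and> hdifferentiable I \<psi> g \<xi>0 \<and>
       (D_exists I \<phi> \<xi>0 \<or> D_exists I \<psi> \<xi>0) \<longrightarrow>
       hdifferentiable I (\<lambda>\<xi>. \<phi> \<xi> + \<psi> \<xi>) (\<lambda>x. f x + g x) \<xi>0 \<and>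
       (\<forall>x\<in>monad (hconst \<xi>0).
          hderiv I (\<lambda>\<xi>. \<phi> \<xi> + \<psi> \<xi>) (\<lambda>x. f x + g x) x = hderiv I \<phi> f x + hderiv I \<psi> g x)"
  proof (intro impI; elim conjE)
    assume "hdifferentiable I \<phi> f \<xi>0" "hdifferentiable I \<psi> g \<xi>0"
      and D: "D_exists I \<phi> \<xi>0 \<or> D_exists I \<psi> \<xi>0"
    then have f: "has_hderiv I \<phi> f \<xi>0 a" and g: "has_hderiv I \<psi> g \<xi>0 b"
      by (simp_all add: a_def b_def hdifferentiable_has_hderiv)
    show "hdifferentiable I (\<lambda>\<xi>. \<phi> \<xi> + \<psi> \<xi>) (\<lambda>x. f x + g x) \<xi>0 \<and>
       (\<forall>x\<in>monad (hconst \<xi>0).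
          hderiv I (\<lambda>\<xi>. \<phi> \<xi> + \<psi> \<xi>) (\<lambda>x. f x + g x) x = hderiv I \<phi> f x + hderiv I \<psi> g x)"
      using differentiable[OF indisc_ext_add[OF ext_f ext_g] has_hderiv_add[OF f g D]]
      by (simp add: a b)
  qed
  have part_c: "hdifferentiable I \<phi> f \<xi>0 \<and> hdifferentiable I \<psi> g \<xi>0 \<and>
       ((D_exists I \<phi> \<xi>0 \<and> D_exists I \<psi> \<xi>0) \<or>
        (\<phi> \<xi>0 \<noteq> 0 \<and> D_exists I \<phi> \<xi>0 \<and> lim_exists I \<psi> \<xi>0 \<and> \<not> D_exists I \<psi> \<xi>0) \<or>
        (\<psi> \<xi>0 \<noteq> 0 \<and> D_exists I \<psi> \<xi>0 \<and> lim_exists I \<phi> \<xi>0 \<and> \<not> D_exists I \<phi> \<xi>0)) \<longrightarrow>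
       hdifferentiable I (\<lambda>\<xi>. \<phi> \<xi> * \<psi> \<xi>) (\<lambda>x. f x * g x) \<xi>0 \<and>
       (\<forall>x\<in>monad (hconst \<xi>0).
          hconst (hderiv I (\<lambda>\<xi>. \<phi> \<xi> * \<psi> \<xi>) (\<lambda>x. f x * g x) x) =
            hconst (hderiv I \<phi> f x) * g (hconst \<xi>0) + hconst (hderiv I \<psi> g x) * f (hconst \<xi>0))"
  proof (intro impI; elim conjE)
    assume "hdifferentiable I \<phi> f \<xi>0" "hdifferentiable I \<psi> g \<xi>0"
      and D: "(D_exists I \<phi> \<xi>0 \<and> D_exists I \<psi> \<xi>0) \<or>
        (\<phi> \<xi>0 \<noteq> 0 \<and> D_exists I \<phi> \<xi>0 \<and> lim_exists I \<psi> \<xi>0 \<and> \<not> D_exists I \<psi> \<xi>0) \<or>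
        (\<psi> \<xi>0 \<noteq> 0 \<and> D_exists I \<psi> \<xi>0 \<and> lim_exists I \<phi> \<xi>0 \<and> \<not> D_exists I \<phi> \<xi>0)"
    then have f: "has_hderiv I \<phi> f \<xi>0 a" and g: "has_hderiv I \<psi> g \<xi>0 b"
      by (simp_all add: a_def b_def hdifferentiable_has_hderiv)
    \<comment> \<open>In each of the three cases some factor has a classical derivative, together
      with that of the other factor or with its own nonvanishing at \<xi>0.\<close>
    have "has_hderiv I (\<lambda>\<xi>. \<phi> \<xi> * \<psi> \<xi>) (\<lambda>x. f x * g x) \<xi>0 (a * \<psi> \<xi>0 + b * \<phi> \<xi>0)"
      using has_hderiv_mult[OF I f g] D by blast
    from differentiable[OF indisc_ext_mult[OF ext_f ext_g] this]
    show "hdifferentiable I (\<lambda>\<xi>. \<phi> \<xi> * \<psi> \<xi>) (\<lambda>x. f x * g x) \<xi>0 \<and>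
       (\<forall>x\<in>monad (hconst \<xi>0).
          hconst (hderiv I (\<lambda>\<xi>. \<phi> \<xi> * \<psi> \<xi>) (\<lambda>x. f x * g x) x) =
            hconst (hderiv I \<phi> f x) * g (hconst \<xi>0) + hconst (hderiv I \<psi> g x) * f (hconst \<xi>0))"
      by (simp add: a b f\<xi>0 g\<xi>0 hconst_add hconst_mult)
  qed
  have part_d: "hdifferentiable I \<phi> f \<xi>0 \<and> hdifferentiable I \<psi> g \<xi>0 \<and> (\<forall>\<xi>\<in>I. \<psi> \<xi> \<noteq> 0) \<and>
       ((D_exists I \<phi> \<xi>0 \<and> D_exists I \<psi> \<xi>0) \<or>
        (\<phi> \<xi>0 \<noteq> 0 \<and> D_exists I \<phi> \<xi>0 \<and> lim_exists I (\<lambda>\<xi>. 1 / \<psi> \<xi>) \<xi>0 \<and>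
           \<not> D_exists I (\<lambda>\<xi>. 1 / \<psi> \<xi>) \<xi>0) \<or>
        (D_exists I (\<lambda>\<xi>. 1 / \<psi> \<xi>) \<xi>0 \<and> lim_exists I \<phi> \<xi>0 \<and> \<not> D_exists I \<phi> \<xi>0)) \<longrightarrow>
       hdifferentiable I (\<lambda>\<xi>. \<phi> \<xi> / \<psi> \<xi>) (\<lambda>x. f x / g x) \<xi>0 \<and>
       (\<forall>x\<in>monad (hconst \<xi>0).
          hconst (hderiv I (\<lambda>\<xi>. \<phi> \<xi> / \<psi> \<xi>) (\<lambda>x. f x / g x) x) =
            (hconst (hderiv I \<phi> f x) * g (hconst \<xi>0) - hconst (hderiv I \<psi> g x) * f (hconst \<xi>0))
              / (g (hconst \<xi>0)) ^ 2)"
  proof (intro impI; elim conjE)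
    assume "hdifferentiable I \<phi> f \<xi>0" "hdifferentiable I \<psi> g \<xi>0"
      and nz: "\<forall>\<xi>\<in>I. \<psi> \<xi> \<noteq> 0"
      and D: "(D_exists I \<phi> \<xi>0 \<and> D_exists I \<psi> \<xi>0) \<or>
        (\<phi> \<xi>0 \<noteq> 0 \<and> D_exists I \<phi> \<xi>0 \<and> lim_exists I (\<lambda>\<xi>. 1 / \<psi> \<xi>) \<xi>0 \<and>
           \<not> D_exists I (\<lambda>\<xi>. 1 / \<psi> \<xi>) \<xi>0) \<or>
        (D_exists I (\<lambda>\<xi>. 1 / \<psi> \<xi>) \<xi>0 \<and> lim_exists I \<phi> \<xi>0 \<and> \<not> D_exists I \<phi> \<xi>0)"
    then have f: "has_hderiv I \<phi> f \<xi>0 a" and g: "has_hderiv I \<psi> g \<xi>0 b"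
      by (simp_all add: a_def b_def hdifferentiable_has_hderiv)
    have nz0: "\<psi> \<xi>0 \<noteq> 0"
      using nz I(2) by blast
    \<comment> \<open>If \<psi> has a classical derivative, so has 1/\<psi>. With this, and since
      1/\<psi> is nonzero at \<xi>0, all three cases are instances of the product rule for f and the
      reciprocal of g.\<close>
    have "D_exists I (\<lambda>\<xi>. 1 / \<psi> \<xi>) \<xi>0" if "D_exists I \<psi> \<xi>0"
      using that nz0 has_D_inverse unfolding D_exists_def by blast
    then have "has_hderiv I (\<lambda>\<xi>. \<phi> \<xi> * (1 / \<psi> \<xi>)) (\<lambda>x. f x * inverse (g x)) \<xi>0
        (a * (1 / \<psi> \<xi>0) + - b / (\<psi> \<xi>0)\<^sup>2 * \<phi> \<xi>0)"
      using D nz0 by (intro has_hderiv_mult[OF I f has_hderiv_inverse[OF g nz0]]) auto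
    moreover have "indisc_ext I (\<lambda>\<xi>. \<phi> \<xi> * (1 / \<psi> \<xi>)) (\<lambda>x. f x * inverse (g x))"
      using nz by (intro indisc_ext_mult indisc_ext_inverse ext_f ext_g) auto
    moreover have "a * (1 / \<psi> \<xi>0) +
        - b / (\<psi> \<xi>0)\<^sup>2 * \<phi> \<xi>0 = (a * \<psi> \<xi>0 - b * \<phi> \<xi>0) * (1 / (\<psi> \<xi>0)\<^sup>2)"
      using nz0 by (simp add: field_simps power2_eq_square)
    ultimately have *: "hdifferentiable I (\<lambda>\<xi>. \<phi> \<xi> / \<psi> \<xi>) (\<lambda>x. f x / g x) \<xi>0 \<and>
        (\<forall>x\<in>monad (hconst \<xi>0). hderiv I (\<lambda>\<xi>. \<phi> \<xi> / \<psi> \<xi>) (\<lambda>x. f x / g x) x =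
          (a * \<psi> \<xi>0 - b * \<phi> \<xi>0) * (1 / (\<psi> \<xi>0)\<^sup>2))"
      using differentiable by (simp add: divide_hreal_eq)
    \<comment> \<open>The real quotient carries over to the ring because the square of
      \<psi>(\<xi>0) is nonzero, so its constant sequence is a unit.\<close>
    have quotient: "hconst ((a * \<psi> \<xi>0 - b * \<phi> \<xi>0) * (1 / (\<psi> \<xi>0)\<^sup>2)) =
        (hconst a * hconst (\<psi> \<xi>0) - hconst b * hconst (\<phi> \<xi>0)) / hconst (\<psi> \<xi>0) ^ 2"
      by (simp only: divide_hreal_eq hconst_power[symmetric] inverse_hconst[OF power_not_zero[OF nz0]]
          hconst_mult hconst_diff)
    from * show "hdifferentiable I (\<lambda>\<xi>. \<phi> \<xi> / \<psi> \<xi>) (\<lambda>x. f x / g x) \<xi>0 \<and>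
       (\<forall>x\<in>monad (hconst \<xi>0).
          hconst (hderiv I (\<lambda>\<xi>. \<phi> \<xi> / \<psi> \<xi>) (\<lambda>x. f x / g x) x) =
            (hconst (hderiv I \<phi> f x) * g (hconst \<xi>0) - hconst (hderiv I \<psi> g x) * f (hconst \<xi>0))
              / (g (hconst \<xi>0)) ^ 2)"
      unfolding f\<xi>0 g\<xi>0 using quotient by (auto simp only: a b)
  qed
  have part_e: "\<forall>m::nat. m \<ge> 1 \<and> hdifferentiable I \<phi> f \<xi>0 \<and>
       (D_exists I \<phi> \<xi>0 \<or>
        (continuous (at \<xi>0 within I) \<phi> \<and> \<phi> \<xi>0 \<noteq> 0 \<and> \<not> D_exists I \<phi> \<xi>0)) \<longrightarrow>
       hdifferentiable I (\<lambda>\<xi>. \<phi> \<xi> ^ m) (\<lambda>x. f x ^ m) \<xi>0 \<and>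
       (\<forall>x\<in>monad (hconst \<xi>0).
          hconst (hderiv I (\<lambda>\<xi>. \<phi> \<xi> ^ m) (\<lambda>x. f x ^ m) x) =
            hconst (real m) * f (hconst \<xi>0) ^ (m - 1) * hconst (hderiv I \<phi> f x))"
  proof (intro allI impI; elim conjE)
    fix m :: nat
    assume m: "m \<ge> 1" and "hdifferentiable I \<phi> f \<xi>0"
      and D: "D_exists I \<phi> \<xi>0 \<or>
        (continuous (at \<xi>0 within I) \<phi> \<and> \<phi> \<xi>0 \<noteq> 0 \<and> \<not> D_exists I \<phi> \<xi>0)"
    then have f: "has_hderiv I \<phi> f \<xi>0 a"
      by (simp add: a_def hdifferentiable_has_hderiv)
    have "has_hderiv I (\<lambda>\<xi>. \<phi> \<xi> ^ m) (\<lambda>x. f x ^ m) \<xi>0 (real m * \<phi> \<xi>0 ^ (m - 1) * a)"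
      using has_hderiv_power[OF I f m] D by blast
    from differentiable[OF indisc_ext_power[OF ext_f] this]
    show "hdifferentiable I (\<lambda>\<xi>. \<phi> \<xi> ^ m) (\<lambda>x. f x ^ m) \<xi>0 \<and>
       (\<forall>x\<in>monad (hconst \<xi>0).
          hconst (hderiv I (\<lambda>\<xi>. \<phi> \<xi> ^ m) (\<lambda>x. f x ^ m) x) =
            hconst (real m) * f (hconst \<xi>0) ^ (m - 1) * hconst (hderiv I \<phi> f x))"
      by (simp add: a f\<xi>0 hconst_mult hconst_power)
  qed
  have part_f: "\<forall>m::nat. m \<ge> 1 \<and> hdifferentiable I \<phi> f \<xi>0 \<and> (\<forall>\<xi>\<in>I. \<phi> \<xi> > 0) \<longrightarrow>
       hdifferentiable I (\<lambda>\<xi>. root m (\<phi> \<xi>)) (\<lambda>x. hroot m (f x)) \<xi>0 \<and>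
       (\<forall>x\<in>monad (hconst \<xi>0).
          hconst (hderiv I (\<lambda>\<xi>. root m (\<phi> \<xi>)) (\<lambda>x. hroot m (f x)) x) =
            hconst (hderiv I \<phi> f x) / (hconst (real m) * hroot m (f (hconst \<xi>0) ^ (m - 1))))"
  proof (intro allI impI; elim conjE)
    fix m :: nat
    assume m: "m \<ge> 1" and "hdifferentiable I \<phi> f \<xi>0" and pos: "\<forall>\<xi>\<in>I. \<phi> \<xi> > 0"
    then have f: "has_hderiv I \<phi> f \<xi>0 a"
      by (simp add: a_def hdifferentiable_has_hderiv)
    have pos0: "\<phi> \<xi>0 > 0"
      using pos I(2) by blast
    define c where "c = real m * root m (\<phi> \<xi>0) ^ (m - 1)"
    have c: "c \<noteq> 0"
      using m pos0 by (simp add: c_def)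
    \<comment> \<open>\<open>has_hderiv_hroot\<close> delivers a power of the root, the claim has a
      root of the power; they agree because \<phi>(\<xi>0) is positive.\<close>
    have "hroot m (hconst (\<phi> \<xi>0) ^ (m - 1)) = hconst (root m (\<phi> \<xi>0) ^ (m - 1))"
      using m pos0 by (simp add: hconst_power[symmetric] hroot_hconst real_root_power)
    then have denominator: "hconst (real m) * hroot m (f (hconst \<xi>0) ^ (m - 1)) = hconst c"
      by (simp only: f\<xi>0 c_def hconst_mult)
    have "hconst (a / c) = hconst a / (hconst (real m) * hroot m (f (hconst \<xi>0) ^ (m - 1)))"
      unfolding denominator divide_hreal_eq inverse_hconst[OF c] hconst_mult[symmetric] by simp
    moreover have "hdifferentiable I (\<lambda>\<xi>. root m (\<phi> \<xi>)) (\<lambda>x. hroot m (f x)) \<xi>0 \<and>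
       (\<forall>x\<in>monad (hconst \<xi>0). hderiv I (\<lambda>\<xi>. root m (\<phi> \<xi>)) (\<lambda>x. hroot m (f x)) x = a / c)"
      using pos m unfolding c_def
      by (intro differentiable indisc_ext_hroot has_hderiv_hroot ext_f f I) auto
    ultimately show "hdifferentiable I (\<lambda>\<xi>. root m (\<phi> \<xi>)) (\<lambda>x. hroot m (f x)) \<xi>0 \<and>
       (\<forall>x\<in>monad (hconst \<xi>0).
          hconst (hderiv I (\<lambda>\<xi>. root m (\<phi> \<xi>)) (\<lambda>x. hroot m (f x)) x) =
            hconst (hderiv I \<phi> f x) / (hconst (real m) * hroot m (f (hconst \<xi>0) ^ (m - 1))))"
      by (simp add: a)
  qed
  show ?thesis
    by (intro conjI part_a part_b part_c part_d part_e part_f)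
qed

end
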